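(* Assume that: (1) there exist two functions $\alpha:[1,m]_{\mathbb Z}\times[1,n]_{\mathbb Z}\to(0,+\infty)$ and $\beta:[1,m]_{\mathbb Z}\times[1,n]_{\mathbb Z}\to\mathbb R$ and a constant $K>0$ such that $$F((i,j),t)\ge\alpha(i,j)t^{2}+\beta(i,j)\qquad\text{for all }(i,j)\in[1,m]_{\mathbb Z}\times[1,n]_{\mathbb Z}\text{ and all }|t|>K;$$ (2) $\displaystyle\lim_{|t|\to0}\frac{F((i,j),t)}{t^{2}}=0$ for all $(i,j)\in[1,m]_{\mathbb Z}\times[1,n]_{\mathbb Z}$. Let $\alpha^{-}=\min\{\alpha(i,j):(i,j)\in[1,m]_{\mathbb Z}\times[1,n]_{\mathbb Z}\}$ and let $\lambda_{mn}$ be the largest eigenvalue of the matrix $M$ defined in the context. Then, for each $\lambda>\dfrac{\lambda_{mn}}{2\alpha^{-}}$, the discrete boundary value problem $$\begin{cases}-\Delta_1\big(p(i-1,j)\Delta_1u(i-1,j)\big)-\Delta_2\big(p(i,j-1)\Delta_2u(i,j-1)\big)=\lambda f((i,j),u(i,j)), & (i,j)\in[1,m]_{\mathbb Z}\times[1,n]_{\mathbb Z},\\ u(0,j)=u(m+1,j)=0, & j\in[1,n]_{\mathbb Z},\\ u(i,0)=u(i,n+1)=0, & i\in[1,m]_{\mathbb Z},\end{cases}$$ has at least one nontrivial solution.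
   Context: Let $m,n\ge 1$ be integers. For integers $a\le b$ write $[a,b]_{\mathbb Z}=\{a,a+1,\dots,b\}$. The forward difference operators are $\Delta_1u(i,j)=u(i+1,j)-u(i,j)$ and $\Delta_2u(i,j)=u(i,j+1)-u(i,j)$; thus $\Delta_1(p(i-1,j)\Delta_1u(i-1,j))=p(i,j)(u(i+1,j)-u(i,j))-p(i-1,j)(u(i,j)-u(i-1,j))$ and $\Delta_2(p(i,j-1)\Delta_2u(i,j-1))=p(i,j)(u(i,j+1)-u(i,j))-p(i,j-1)(u(i,j)-u(i,j-1))$. Standing assumptions: the weight $p:[0,m]_{\mathbb Z}\times[0,n]_{\mathbb Z}\to[0,+\infty)$ is a given function with $p(0,j)=0$ for all $j\in[1,n]_{\mathbb Z}$, $p(i,0)=0$ for all $i\in[1,m]_{\mathbb Z}$, and $p(i,j)>0$ for all $(i,j)\in[1,m]_{\mathbb Z}\times[1,n]_{\mathbb Z}$ (the value $p(0,0)$ does not enter the problem). The function $f:[1,m]_{\mathbb Z}\times[1,n]_{\mathbb Z}\times\mathbb R\to\mathbb R$ is continuous, i.e. $f((i,j),\cdot)$ is continuous for each $(i,j)$, and $F((i,j),x)=\int_0^xf((i,j),t)\,dt$. The number $\lambda$ is a positive real parameter. A solution is a real-valued function $u$ of the grid points (interior points $[1,m]_{\mathbb Z}\times[1,n]_{\mathbb Z}$ together with the boundary points listed in the problem) satisfying all the equations and boundary conditions; it is nontrivial if $u(i,j)\ne0$ for some $(i,j)\in[1,m]_{\mathbb Z}\times[1,n]_{\mathbb Z}$.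 The matrix $M$: it is the real symmetric $mn\times mn$ block tridiagonal matrix with $m\times m$ blocks, whose diagonal blocks are $L_1,\dots,L_n$, whose $(j,j+1)$ and $(j+1,j)$ blocks are both $-P_j$ for $j\in[1,n-1]_{\mathbb Z}$, and whose other blocks are zero. Here $P_j=\mathrm{diag}(p(1,j),\dots,p(m,j))$, and $L_j$ is the symmetric tridiagonal matrix with $(k,k)$ entry $p(k-1,j)+2p(k,j)+p(k,j-1)$ for $k\in[1,m]_{\mathbb Z}$ and with $(k,k+1)$ and $(k+1,k)$ entries both equal to $-p(k,j)$ for $k\in[1,m-1]_{\mathbb Z}$. Its eigenvalues are ordered as $\lambda_1\le\lambda_2\le\dots\le\lambda_{mn}$. *)

theory Defs
  imports "HOL-Analysis.Analysis" "Jordan_Normal_Form.Spectral_Radius"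
begin

(* Grid functions are total functions on nat \<times> nat; only their values at the grid points occurring
   in the problem are ever constrained.  Every subtraction i - 1 or j - 1 below is used with
   i \<ge> 1 or j \<ge> 1, so truncation of natural-number subtraction never plays a role. *)

definition interior_grid :: "nat \<Rightarrow> nat \<Rightarrow> (nat \<times> nat) set" where
  "interior_grid m n = {1..m} \<times> {1..n}"

definition forward_diff1 :: "(nat \<times> nat \<Rightarrow> real) \<Rightarrow> nat \<times> nat \<Rightarrow> real" ("\<Delta>\<^sub>1") where
  "\<Delta>\<^sub>1 u = (\<lambda>(i, j). u (i + 1, j) - u (i, j))"

definition forward_diff2 :: "(nat \<times> nat \<Rightarrow> real) \<Rightarrow> nat \<times> nat \<Rightarrow> real" ("\<Delta>\<^sub>2") where
  "\<Delta>\<^sub>2 u = (\<lambda>(i, j). u (i, j + 1) - u (i, j))"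

definition admissible_weight :: "nat \<Rightarrow> nat \<Rightarrow> (nat \<times> nat \<Rightarrow> real) \<Rightarrow> bool" where
  "admissible_weight m n p \<longleftrightarrow>
     (\<forall>i\<in>{0..m}. \<forall>j\<in>{0..n}. 0 \<le> p (i, j)) \<and>
     (\<forall>j\<in>{1..n}. p (0, j) = 0) \<and>
     (\<forall>i\<in>{1..m}. p (i, 0) = 0) \<and>
     (\<forall>i\<in>{1..m}. \<forall>j\<in>{1..n}. 0 < p (i, j))"

(* The interval integral is oriented: for x < 0 it is minus the integral over {x<..<0}. *)
definition primitive :: "(nat \<times> nat \<Rightarrow> real \<Rightarrow> real) \<Rightarrow> nat \<times> nat \<Rightarrow> real \<Rightarrow> real" where
  "primitive f z x = (LBINT t=ereal 0..ereal x. f z t)"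

definition solves_problem ::
  "nat \<Rightarrow> nat \<Rightarrow> (nat \<times> nat \<Rightarrow> real) \<Rightarrow> (nat \<times> nat \<Rightarrow> real \<Rightarrow> real) \<Rightarrow> real
     \<Rightarrow> (nat \<times> nat \<Rightarrow> real) \<Rightarrow> bool" where
  "solves_problem m n p f lam u \<longleftrightarrow>
     (\<forall>i\<in>{1..m}. \<forall>j\<in>{1..n}.
        - \<Delta>\<^sub>1 (\<lambda>(k, l). p (k - 1, l) * \<Delta>\<^sub>1 u (k - 1, l)) (i, j)
        - \<Delta>\<^sub>2 (\<lambda>(k, l). p (k, l - 1) * \<Delta>\<^sub>2 u (k, l - 1)) (i, j)
        = lam * f (i, j) (u (i, j))) \<and>
     (\<forall>j\<in>{1..n}. u (0, j) = 0 \<and> u (m + 1, j) = 0) \<and>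
     (\<forall>i\<in>{1..m}. u (i, 0) = 0 \<and> u (i, n + 1) = 0)"

definition nontrivial :: "nat \<Rightarrow> nat \<Rightarrow> (nat \<times> nat \<Rightarrow> real) \<Rightarrow> bool" where
  "nontrivial m n u \<longleftrightarrow> (\<exists>z\<in>interior_grid m n. u z \<noteq> 0)"

(* Matrix rows and columns are indexed from 0, so row k of a block belongs to the abscissa k + 1;
   the index j of L_block and P_block is the ordinate itself, counted from 1. *)
definition P_block :: "nat \<Rightarrow> (nat \<times> nat \<Rightarrow> real) \<Rightarrow> nat \<Rightarrow> real mat" where
  "P_block m p j = mat_diag m (\<lambda>k. p (k + 1, j))"

definition L_block :: "nat \<Rightarrow> (nat \<times> nat \<Rightarrow> real) \<Rightarrow> nat \<Rightarrow> real mat" where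
  "L_block m p j = Matrix.mat m m (\<lambda>(k, l).
     if k = l then p (k, j) + 2 * p (k + 1, j) + p (k + 1, j - 1)
     else if l = k + 1 then - p (k + 1, j)
     else if k = l + 1 then - p (l + 1, j)
     else 0)"

definition M_block :: "nat \<Rightarrow> (nat \<times> nat \<Rightarrow> real) \<Rightarrow> nat \<Rightarrow> nat \<Rightarrow> real mat" where
  "M_block m p a b =
     (if a = b then L_block m p a
      else if b = a + 1 then - P_block m p a
      else if a = b + 1 then - P_block m p b
      else 0\<^sub>m m m)"

definition M_matrix :: "nat \<Rightarrow> nat \<Rightarrow> (nat \<times> nat \<Rightarrow> real) \<Rightarrow> real mat" where
  "M_matrix m n p = Matrix.mat (m * n) (m * n) (\<lambda>(r, c).
     M_block m p (r div m + 1) (c div m + 1) $$ (r mod m, c mod m))"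

(* The spectrum is finite, and for m, n \<ge> 1 it is nonempty because M_matrix is real symmetric. *)
definition largest_eigenvalue :: "real mat \<Rightarrow> real" where
  "largest_eigenvalue A = Max (spectrum A)"

end

theory Submission
  imports Defs
begin

text \<open>
The problem is variational. Its left-hand side is the action of the symmetric matrix \<open>M_matrix\<close>
on the function \<open>u\<close>, extended by zero to the boundary, so solutions are the critical points of the energy
\<open>E u = u \<bullet> M u / 2 - \<lambda> * (\<Sum>z. F z (u z))\<close>, where \<open>F z\<close> is the primitive of \<open>f z\<close>.

The energy attains a maximum. By the Rayleigh principle the quadratic term is at most half of the largest
eigenvalue times \<open>|u|^2\<close>, while the growth hypothesis bounds the second term from below by
\<open>\<lambda> * \<alpha>\<^sup>- * |u|^2\<close> up to a constant, where \<open>\<alpha>\<^sup>-\<close> is the minimum of \<open>\<alpha>\<close>. The assumption on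
\<open>\<lambda>\<close> says exactly that the second coefficient is the larger one, so \<open>E\<close> tends to \<open>-\<infinity>\<close> at
infinity (\<open>coercive_energy_attains_max\<close>). A maximizer is a critical point (\<open>energy_maximizer_is_critical\<close>).

The maximizer is not zero. At the origin the energy is 0; but for small \<open>t\<close>, on the axis of one grid
point, the quadratic term is a positive multiple of \<open>t^2\<close> and \<open>F\<close> is \<open>o(t^2)\<close>, so the energy
takes positive values (\<open>energy_positive_somewhere\<close>).

The Rayleigh principle itself comes from the same criticality argument (\<open>extremal_eigenpair\<close>): a maximizer of
the quadratic form on the sphere is an eigenvector, so the maximum is an eigenvalue and hence at most the
largest one.
\<close>

section \<open>Energies of symmetric kernels and their critical points\<close>

definition kernel_apply :: "'a set \<Rightarrow> ('a \<Rightarrow> 'a \<Rightarrow> real) \<Rightarrow> ('a \<Rightarrow> real) \<Rightarrow> 'a \<Rightarrow> real" where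
  "kernel_apply S A u z = (\<Sum>w\<in>S. A z w * u w)"

definition quad_form :: "'a set \<Rightarrow> ('a \<Rightarrow> 'a \<Rightarrow> real) \<Rightarrow> ('a \<Rightarrow> real) \<Rightarrow> real" where
  "quad_form S A u = (\<Sum>z\<in>S. u z * kernel_apply S A u z)"

text \<open>The term \<open>G z\<close> is a potential of the nonlinearity at the point \<open>z\<close>: for symmetric \<open>A\<close>, the critical points of
this functional among the functions supported on \<open>S\<close> are the solutions of \<open>A u = G' u\<close>.\<close>
definition energy :: "'a set \<Rightarrow> ('a \<Rightarrow> 'a \<Rightarrow> real) \<Rightarrow> ('a \<Rightarrow> real \<Rightarrow> real) \<Rightarrow> ('a \<Rightarrow> real) \<Rightarrow> real" where
  "energy S A G u = quad_form S A u / 2 - (\<Sum>z\<in>S. G z (u z))"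

text \<open>Extension by zero makes the functions on \<open>S\<close> a subset of a product space, whose topology supplies
compactness whatever the size of \<open>S\<close>, and at the same time encodes homogeneous Dirichlet conditions.\<close>
definition supported_on :: "'a set \<Rightarrow> ('a \<Rightarrow> real) set" where
  "supported_on S = {u. \<forall>z. z \<notin> S \<longrightarrow> u z = 0}"

lemma supported_on_upd:
  "u \<in> supported_on S \<Longrightarrow> z \<in> S \<Longrightarrow> u(z := t) \<in> supported_on S"
  by (auto simp: supported_on_def)

lemma quad_form_upd:
  assumes "finite S" "z \<in> S" and sym: "\<And>x y. x \<in> S \<Longrightarrow> y \<in> S \<Longrightarrow> A x y = A y x"
  shows "quad_form S A (u(z := u z + t))
           = quad_form S A u + 2 * t * kernel_apply S A u z + t\<^sup>2 * A z z"
proof -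
  define e where "e w = (if w = z then t else 0)" for w
  have upd: "u(z := u z + t) = (\<lambda>w. u w + e w)"
    by (auto simp: e_def)
  have kap: "kernel_apply S A (\<lambda>w. u w + e w) x = kernel_apply S A u x + A x z * t" for x
  proof -
    have "(\<Sum>w\<in>S. A x w * e w) = A x z * t"
      using assms(1,2) by (simp add: e_def if_distrib cong: if_cong)
    then show ?thesis
      by (simp add: kernel_apply_def distrib_left sum.distrib)
  qed
  have "(\<Sum>x\<in>S. u x * A x z) = kernel_apply S A u z"
    unfolding kernel_apply_def using assms by (intro sum.cong) auto
  then have cross: "(\<Sum>x\<in>S. u x * (A x z * t)) = t * kernel_apply S A u z"
    by (simp add: sum_distrib_left[symmetric] sum_distrib_right[symmetric] mult.assoc[symmetric])
  have el: "(\<Sum>x\<in>S. e x * h x) = t * h z" for h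
    using assms(1,2) by (simp add: e_def if_distrib if_distribR cong: if_cong)
  have "quad_form S A (\<lambda>w. u w + e w)
      = (\<Sum>x\<in>S. u x * kernel_apply S A u x) + (\<Sum>x\<in>S. u x * (A x z * t))
        + (\<Sum>x\<in>S. e x * (kernel_apply S A u x + A x z * t))"
    unfolding quad_form_def kap by (simp add: algebra_simps sum.distrib)
  then show ?thesis
    unfolding upd el cross by (simp add: quad_form_def algebra_simps power2_eq_square)
qed

lemma sum_upd:
  fixes G :: "'a \<Rightarrow> real \<Rightarrow> real"
  assumes "finite S" "z \<in> S"
  shows "(\<Sum>w\<in>S. G w ((u(z := t)) w)) = (\<Sum>w\<in>S. G w (u w)) - G z (u z) + G z t"
proof -
  have "(\<Sum>w\<in>S - {z}. G w ((u(z := t)) w)) = (\<Sum>w\<in>S - {z}. G w (u w))"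
    by (intro sum.cong) auto
  then show ?thesis
    using assms by (simp add: sum.remove)
qed

text \<open>Varying the single coordinate \<open>z\<close> of a maximizer gives a function of one real variable with a maximum at 0,
and its derivative there is the difference of the two sides.\<close>
lemma energy_maximizer_is_critical:
  assumes "finite S" "z \<in> S" and sym: "\<And>x y. x \<in> S \<Longrightarrow> y \<in> S \<Longrightarrow> A x y = A y x"
    and u: "u \<in> supported_on S"
    and max: "\<And>v. v \<in> supported_on S \<Longrightarrow> energy S A G v \<le> energy S A G u"
    and der: "(G z has_real_derivative g) (at (u z))"
  shows "kernel_apply S A u z = g"
proof -
  define h where "h t = energy S A G (u(z := u z + t))" for t
  have h: "h t = quad_form S A u / 2 + t * kernel_apply S A u z + t\<^sup>2 * A z z / 2
      - ((\<Sum>w\<in>S. G w (u w)) - G z (u z) + G z (u z + t))" for t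
  proof -
    have "quad_form S A (u(z := u z + t))
        = quad_form S A u + 2 * t * kernel_apply S A u z + t\<^sup>2 * A z z"
      by (rule quad_form_upd[OF assms(1,2) sym])
    then show ?thesis
      unfolding h_def energy_def sum_upd[OF assms(1,2)] by (simp add: add_divide_distrib)
  qed
  have shift: "((\<lambda>t. G z (u z + t)) has_real_derivative g) (at 0)"
    using der DERIV_shift[of "G z" g 0 "u z"] by (simp add: add.commute)
  have "(h has_real_derivative kernel_apply S A u z - g) (at 0)"
    unfolding h by (auto intro!: derivative_eq_intros shift)
  moreover have "h t \<le> h 0" for t
    unfolding h_def using max[OF supported_on_upd[OF u assms(2)]] by simp
  ultimately have "kernel_apply S A u z - g = 0"
    by (intro DERIV_local_max[where f = h and x = 0 and d = 1]) auto
  then show ?thesis by simp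
qed

section \<open>Compactness, continuity and the largest eigenvalue\<close>

text \<open>The box is a product of compact intervals (degenerate off \<open>S\<close>), so this is an instance of Tychonoff's theorem.\<close>
lemma compact_supported_box:
  "compact {u \<in> supported_on S. \<forall>z\<in>S. \<bar>u z\<bar> \<le> (R::real)}"
proof -
  have "compactin (product_topology (\<lambda>_. euclidean) UNIV)
          (PiE UNIV (\<lambda>z. if z \<in> S then {-R..R} else {0::real}))"
    by (subst compactin_PiE) auto
  moreover have "PiE UNIV (\<lambda>z. if z \<in> S then {-R..R} else {0::real})
      = {u \<in> supported_on S. \<forall>z\<in>S. \<bar>u z\<bar> \<le> R}"
    by (auto simp: supported_on_def PiE_def Pi_def abs_le_iff split: if_splits; smt (verit))
  ultimately show ?thesis
    by (simp add: euclidean_product_topology)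
qed

lemma continuous_on_coordinate: "continuous_on T (\<lambda>u::'a \<Rightarrow> real. u z)"
  by (rule continuous_on_subset[OF continuous_on_product_coordinates]) simp

lemma continuous_on_quad_form: "continuous_on T (quad_form S A)"
  unfolding quad_form_def kernel_apply_def
  by (intro continuous_on_sum continuous_on_mult continuous_on_const continuous_on_coordinate)

lemma continuous_on_energy:
  assumes "\<And>z. z \<in> S \<Longrightarrow> continuous_on UNIV (G z)"
  shows "continuous_on T (energy S A G)"
  unfolding energy_def
proof (intro continuous_on_diff continuous_on_divide continuous_on_sum continuous_on_const
    continuous_on_quad_form)
  fix z assume "z \<in> S"
  then show "continuous_on T (\<lambda>u. G z (u z))"
    by (intro continuous_on_compose2[OF assms continuous_on_coordinate]) auto
qed simp

lemma quad_form_scale: "quad_form S A (\<lambda>z. c * u z) = c\<^sup>2 * quad_form S A u"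
  by (simp add: quad_form_def kernel_apply_def sum_distrib_left power2_eq_square mult_ac)

lemma quad_form_restrict:
  "quad_form S A (\<lambda>z. if z \<in> S then u z else 0) = quad_form S A u"
  by (simp add: quad_form_def kernel_apply_def)

text \<open>The Rayleigh quotient of a symmetric kernel attains its maximum \<open>\<mu>\<close> on the unit sphere. By homogeneity
a maximizer also maximizes \<open>quad_form u - \<mu> * |u|^2\<close> over all \<open>u\<close>, without constraint; twice the energy
with potential \<open>\<mu> t^2 / 2\<close> is that functional, so the criticality of maximizers is the eigenvalue equation.\<close>
lemma extremal_eigenpair:
  assumes fin: "finite S" and "S \<noteq> {}"
    and sym: "\<And>x y. x \<in> S \<Longrightarrow> y \<in> S \<Longrightarrow> A x y = A y x"
  shows "\<exists>\<mu> v. (\<forall>u. quad_form S A u \<le> \<mu> * (\<Sum>z\<in>S. (u z)\<^sup>2))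
    \<and> (\<exists>z\<in>S. v z \<noteq> 0) \<and> (\<forall>z\<in>S. kernel_apply S A v z = \<mu> * v z)"
proof -
  \<comment> \<open>The unit sphere, cut out of a box that contains it so that compactness is visible.\<close>
  define T where "T = {u \<in> supported_on S. \<forall>z\<in>S. \<bar>u z\<bar> \<le> (1::real)}
      \<inter> {u. (\<Sum>z\<in>S. (u z)\<^sup>2) = 1}"
  have "closed {u :: 'a \<Rightarrow> real. (\<Sum>z\<in>S. (u z)\<^sup>2) = 1}"
    by (intro closed_Collect_eq continuous_on_sum continuous_on_power continuous_on_const
        continuous_on_coordinate)
  then have "compact T"
    unfolding T_def by (intro compact_Int_closed compact_supported_box)
  moreover obtain s where "s \<in> S" using \<open>S \<noteq> {}\<close> by blast
  then have "(\<lambda>z. if z = s then 1 else 0) \<in> T"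
    using fin by (auto simp: T_def supported_on_def if_distrib[where f = "\<lambda>x. x\<^sup>2"] cong: if_cong)
  then have "T \<noteq> {}" by blast
  ultimately obtain v where v: "v \<in> T" and vmax: "\<And>u. u \<in> T \<Longrightarrow> quad_form S A u \<le> quad_form S A v"
    using continuous_attains_sup[OF _ _ continuous_on_quad_form] by metis
  define \<mu> where "\<mu> = quad_form S A v"
  have bound0: "quad_form S A u \<le> \<mu> * (\<Sum>z\<in>S. (u z)\<^sup>2)" if u: "u \<in> supported_on S" for u
  proof (cases "(\<Sum>z\<in>S. (u z)\<^sup>2) = 0")
    case True
    then have "\<And>z. z \<in> S \<Longrightarrow> u z = 0"
      using fin by (simp add: sum_nonneg_eq_0_iff)
    then show ?thesis by (simp add: quad_form_def)
  next
    case False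
    define N where "N = (\<Sum>z\<in>S. (u z)\<^sup>2)"
    have N: "N > 0" using False by (simp add: N_def order_less_le sum_nonneg)
    define w where "w = (\<lambda>z. inverse (sqrt N) * u z)"
    have w1: "(\<Sum>z\<in>S. (w z)\<^sup>2) = 1"
      using N by (simp add: w_def power_mult_distrib sum_distrib_left[symmetric] N_def[symmetric]
          power_inverse)
    have "\<bar>w z\<bar> \<le> 1" if "z \<in> S" for z
    proof -
      have "(w z)\<^sup>2 \<le> (\<Sum>z\<in>S. (w z)\<^sup>2)"
        using fin that by (intro member_le_sum) auto
      then show ?thesis using w1 by (simp add: abs_square_le_1)
    qed
    moreover have "w \<in> supported_on S"
      using u by (auto simp: w_def supported_on_def)
    ultimately have "quad_form S A w \<le> \<mu>"
      unfolding \<mu>_def using w1 by (intro vmax) (simp add: T_def)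
    then have "quad_form S A u / N \<le> \<mu>"
      unfolding w_def quad_form_scale using N by (simp add: power_inverse divide_simps)
    then show ?thesis using N by (simp add: N_def[symmetric] divide_simps mult.commute)
  qed
  have bound: "quad_form S A u \<le> \<mu> * (\<Sum>z\<in>S. (u z)\<^sup>2)" for u
    using bound0[of "\<lambda>z. if z \<in> S then u z else 0"]
    by (simp add: quad_form_restrict supported_on_def)
  have v1: "(\<Sum>z\<in>S. (v z)\<^sup>2) = 1" and vS: "v \<in> supported_on S"
    using v by (auto simp: T_def)
  have en: "energy S A (\<lambda>_ t. \<mu> / 2 * t\<^sup>2) u = (quad_form S A u - \<mu> * (\<Sum>z\<in>S. (u z)\<^sup>2)) / 2" for u
    by (simp add: energy_def sum_divide_distrib[symmetric] sum_distrib_left[symmetric] field_simps)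
  have "kernel_apply S A v z = \<mu> * v z" if "z \<in> S" for z
  proof (rule energy_maximizer_is_critical[OF fin that sym vS])
    show "energy S A (\<lambda>_ t. \<mu> / 2 * t\<^sup>2) u \<le> energy S A (\<lambda>_ t. \<mu> / 2 * t\<^sup>2) v" for u
      unfolding en using bound[of u] v1 by (simp add: \<mu>_def)
    show "((\<lambda>t. \<mu> / 2 * t\<^sup>2) has_real_derivative \<mu> * v z) (at (v z))"
      by (auto intro!: derivative_eq_intros)
  qed
  moreover have "\<exists>z\<in>S. v z \<noteq> 0"
    using v1 by (metis (no_types, lifting) sum.neutral zero_neq_one zero_power2)
  ultimately show ?thesis using bound by blast
qed

section \<open>Maximizers of coercive energies\<close>

text \<open>The growth condition is only known for large arguments; on the remaining compact interval continuity bounds the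
difference, at the price of the constant.\<close>
lemma quadratic_lower_bound_everywhere:
  fixes F :: "real \<Rightarrow> real"
  assumes cont: "continuous_on UNIV F"
    and low: "\<And>t. \<bar>t\<bar> > K \<Longrightarrow> F t \<ge> a * t\<^sup>2 + b"
  obtains C where "\<And>t. F t \<ge> a * t\<^sup>2 - C"
proof -
  have "compact ((\<lambda>t. F t - a * t\<^sup>2) ` {-K..K})"
    by (intro compact_continuous_image continuous_intros continuous_on_subset[OF cont]) auto
  then obtain B where B: "\<And>t. t \<in> {-K..K} \<Longrightarrow> \<bar>F t - a * t\<^sup>2\<bar> \<le> B"
    using compact_imp_bounded bounded_iff by (metis (no_types, lifting) imageI real_norm_def)
  have "F t \<ge> a * t\<^sup>2 - (\<bar>B\<bar> + \<bar>b\<bar>)" for t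
  proof (cases "\<bar>t\<bar> > K")
    case True
    then show ?thesis using low[of t] by linarith
  next
    case False
    then have "t \<in> {-K..K}" by auto
    from B[OF this] show ?thesis by linarith
  qed
  then show ?thesis by (rule that)
qed

text \<open>When the potential grows faster than half of the largest value of the quadratic form on the unit
sphere times the squared norm, the energy tends to
\<open>-\<infinity>\<close> at infinity. It is therefore no larger outside a large enough box than at the origin, and the maximum
over the compact box is a global one.\<close>
lemma coercive_energy_attains_max:
  assumes fin: "finite S"
    and bound: "\<And>u. quad_form S A u \<le> \<mu> * (\<Sum>z\<in>S. (u z)\<^sup>2)"
    and cont: "\<And>z. z \<in> S \<Longrightarrow> continuous_on UNIV (G z)"
    and low: "\<And>z t. z \<in> S \<Longrightarrow> G z t \<ge> a * t\<^sup>2 - C z"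
    and "\<mu> < 2 * a"
  shows "\<exists>u\<in>supported_on S. \<forall>v\<in>supported_on S. energy S A G v \<le> energy S A G u"
proof -
  define \<delta> where "\<delta> = a - \<mu> / 2"
  define c where "c = (\<Sum>z\<in>S. C z)"
  define E0 where "E0 = energy S A G (\<lambda>_. 0)"
  have \<delta>: "\<delta> > 0" using assms by (simp add: \<delta>_def)
  have upper: "energy S A G u \<le> c - \<delta> * (\<Sum>z\<in>S. (u z)\<^sup>2)" for u
  proof -
    have "(\<Sum>z\<in>S. a * (u z)\<^sup>2 - C z) \<le> (\<Sum>z\<in>S. G z (u z))"
      by (intro sum_mono low)
    then have "a * (\<Sum>z\<in>S. (u z)\<^sup>2) - c \<le> (\<Sum>z\<in>S. G z (u z))"
      by (simp add: sum_subtractf sum_distrib_left c_def)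
    then show ?thesis
      using bound[of u] by (simp add: energy_def \<delta>_def left_diff_distrib)
  qed
  \<comment> \<open>Chosen so that the upper bound is at most \<open>E0\<close> once some coordinate exceeds \<open>R\<close>.\<close>
  define R where "R = sqrt (\<bar>c - E0\<bar> / \<delta>)"
  have Rnn: "R \<ge> 0" using \<delta> by (simp add: R_def)
  have R2: "\<delta> * R\<^sup>2 = \<bar>c - E0\<bar>" using \<delta> by (simp add: R_def)
  define B where "B = {u \<in> supported_on S. \<forall>z\<in>S. \<bar>u z\<bar> \<le> R}"
  have zB: "(\<lambda>_. 0) \<in> B" using Rnn by (simp add: B_def supported_on_def)
  have "compact B" unfolding B_def by (rule compact_supported_box)
  then have "\<exists>u\<in>B. \<forall>v\<in>B. energy S A G v \<le> energy S A G u"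
    using zB by (intro continuous_attains_sup continuous_on_energy cont) auto
  then obtain u where u: "u \<in> B" and umax: "\<And>v. v \<in> B \<Longrightarrow> energy S A G v \<le> energy S A G u"
    by blast
  have "energy S A G v \<le> energy S A G u" if v: "v \<in> supported_on S" for v
  proof (cases "v \<in> B")
    case False
    then obtain z where z: "z \<in> S" "\<bar>v z\<bar> > R" using v by (auto simp: B_def not_le)
    then have "R\<^sup>2 \<le> (v z)\<^sup>2" using Rnn by (simp add: abs_le_square_iff[symmetric])
    also have "\<dots> \<le> (\<Sum>z\<in>S. (v z)\<^sup>2)" using fin z by (intro member_le_sum) auto
    finally have "\<delta> * R\<^sup>2 \<le> \<delta> * (\<Sum>z\<in>S. (v z)\<^sup>2)" using \<delta> by simp
    then have "energy S A G v \<le> E0" using upper[of v] R2 by linarith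
    then show ?thesis using umax[OF zB] by (simp add: E0_def)
  qed (use umax in blast)
  then show ?thesis using u by (auto simp: B_def)
qed

text \<open>Along the coordinate axis of \<open>z\<close> the quadratic term \<open>A z z * t^2 / 2\<close> dominates the potential, which is
\<open>o(t^2)\<close> at 0. This keeps a maximizer away from the origin, where the energy vanishes.\<close>
lemma energy_positive_somewhere:
  assumes fin: "finite S" and "z \<in> S" and "A z z > 0"
    and sym: "\<And>x y. x \<in> S \<Longrightarrow> y \<in> S \<Longrightarrow> A x y = A y x"
    and zero: "\<And>w. w \<in> S \<Longrightarrow> G w 0 = 0"
    and lim: "((\<lambda>t. G z t / t\<^sup>2) \<longlongrightarrow> 0) (at 0)"
  obtains v where "v \<in> supported_on S" and "energy S A G v > 0"
proof -
  have "eventually (\<lambda>t. G z t / t\<^sup>2 < A z z / 2) (at 0)"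
    using lim \<open>A z z > 0\<close> by (intro order_tendstoD(2)[of _ 0]) auto
  then have "\<forall>\<^sub>F t in at 0. t \<noteq> 0 \<and> G z t / t\<^sup>2 < A z z / 2"
    using eventually_neq_at_within by (rule eventually_conj[rotated])
  then obtain t where t: "t \<noteq> 0" "G z t / t\<^sup>2 < A z z / 2"
    using eventually_happens'[OF at_neq_bot] by blast
  define v where "v = (\<lambda>_. 0)(z := 0 + t)"
  have "quad_form S A v = t\<^sup>2 * A z z"
    using quad_form_upd[OF assms(1,2) sym, where u = "\<lambda>_. 0" and t = t]
    by (simp add: v_def quad_form_def[of _ _ "\<lambda>_. 0"] kernel_apply_def[of _ _ "\<lambda>_. 0"])
  moreover have "(\<Sum>w\<in>S. G w (v w)) = G z t"
    using zero assms(2) by (simp add: v_def sum_upd[OF assms(1,2)] del: fun_upd_apply)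
  ultimately have "energy S A G v > 0"
    using t by (simp add: energy_def field_simps)
  moreover have "v \<in> supported_on S"
    using assms(2) by (auto simp: v_def supported_on_def)
  ultimately show ?thesis using that by blast
qed

text \<open>The variational principle behind the theorem, free of the geometry of the grid: coercivity gives a maximizer,
a positive value of the energy makes it nontrivial, and criticality gives the equation.\<close>
lemma nontrivial_critical_point:
  assumes fin: "finite S" and "s \<in> S" and "A s s > 0"
    and sym: "\<And>x y. x \<in> S \<Longrightarrow> y \<in> S \<Longrightarrow> A x y = A y x"
    and bound: "\<And>u. quad_form S A u \<le> \<mu> * (\<Sum>z\<in>S. (u z)\<^sup>2)"
    and der: "\<And>z t. z \<in> S \<Longrightarrow> (G z has_real_derivative g z t) (at t)"
    and zero: "\<And>z. z \<in> S \<Longrightarrow> G z 0 = 0"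
    and low: "\<And>z t. z \<in> S \<Longrightarrow> \<bar>t\<bar> > K \<Longrightarrow> G z t \<ge> a * t\<^sup>2 + b z"
    and "\<mu> < 2 * a"
    and lim: "((\<lambda>t. G s t / t\<^sup>2) \<longlongrightarrow> 0) (at 0)"
  shows "\<exists>u\<in>supported_on S. (\<forall>z\<in>S. kernel_apply S A u z = g z (u z)) \<and> (\<exists>z\<in>S. u z \<noteq> 0)"
proof -
  have cont: "continuous_on UNIV (G z)" if "z \<in> S" for z
    using der[OF that] DERIV_isCont continuous_at_imp_continuous_on by blast
  have "\<exists>c. \<forall>t. G z t \<ge> a * t\<^sup>2 - c" if "z \<in> S" for z
    using quadratic_lower_bound_everywhere[OF cont[OF that] low[OF that]] by metis
  then have "\<exists>C. \<forall>z\<in>S. \<forall>t. G z t \<ge> a * t\<^sup>2 - C z"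
    by (intro bchoice) blast
  then obtain C where C: "\<And>z t. z \<in> S \<Longrightarrow> G z t \<ge> a * t\<^sup>2 - C z"
    by blast
  obtain u where u: "u \<in> supported_on S"
    and umax: "\<And>v. v \<in> supported_on S \<Longrightarrow> energy S A G v \<le> energy S A G u"
    using coercive_energy_attains_max[where G = G, OF fin bound cont C \<open>\<mu> < 2 * a\<close>] by blast
  obtain v where "v \<in> supported_on S" "energy S A G v > 0"
    by (rule energy_positive_somewhere[where S = S and A = A and G = G and z = s, OF fin \<open>s \<in> S\<close> \<open>A s s > 0\<close> sym zero lim])
  then have "energy S A G u > 0" using umax by fastforce
  moreover have "energy S A G u = 0" if "\<forall>z\<in>S. u z = 0"
    using that zero by (simp add: energy_def quad_form_def)
  ultimately have "\<exists>z\<in>S. u z \<noteq> 0" by force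
  moreover have "kernel_apply S A u z = g z (u z)" if "z \<in> S" for z
    using energy_maximizer_is_critical[where S = S and A = A and G = G, OF fin that sym u umax der[OF that]] by simp
  ultimately show ?thesis using u by blast
qed

section \<open>The difference operator as a symmetric kernel\<close>

text \<open>On the interior grid this is the matrix \<open>M_matrix\<close> with its rows and columns labelled by grid points. In the two cases of
neighbours to the left and below, the weight is taken at the smaller of the two points, which makes the kernel
symmetric.\<close>
definition stiffness :: "(nat \<times> nat \<Rightarrow> real) \<Rightarrow> nat \<times> nat \<Rightarrow> nat \<times> nat \<Rightarrow> real" where
  "stiffness p = (\<lambda>(i, j) (k, l).
     if k = i \<and> l = j then p (i - 1, j) + 2 * p (i, j) + p (i, j - 1)
     else if k = i + 1 \<and> l = j then - p (i, j)
     else if i = k + 1 \<and> l = j then - p (k, l)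
     else if k = i \<and> l = j + 1 then - p (i, j)
     else if k = i \<and> j = l + 1 then - p (k, l)
     else 0)"

lemma stiffness_sym: "stiffness p z w = stiffness p w z"
  by (auto simp: stiffness_def split: prod.splits)

lemma finite_interior_grid: "finite (interior_grid m n)"
  by (simp add: interior_grid_def)

text \<open>The entries in a row of \<open>stiffness\<close> that can be nonzero form the five-point stencil of the difference operator. A neighbour outside
the grid is missing from the sum, and also contributes nothing to the differences because \<open>u\<close> vanishes there.\<close>
lemma kernel_apply_stiffness:
  assumes u: "u \<in> supported_on (interior_grid m n)" and "1 \<le> i" and "1 \<le> j"
  shows "kernel_apply (interior_grid m n) (stiffness p) u (i, j) =
     - \<Delta>\<^sub>1 (\<lambda>(k, l). p (k - 1, l) * \<Delta>\<^sub>1 u (k - 1, l)) (i, j)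
     - \<Delta>\<^sub>2 (\<lambda>(k, l). p (k, l - 1) * \<Delta>\<^sub>2 u (k, l - 1)) (i, j)"
proof -
  \<comment> \<open>Writing the coordinates as successors removes the truncated subtractions.\<close>
  obtain a b where a: "i = Suc a" and b: "j = Suc b"
    using assms(2,3) by (auto simp: Suc_le_eq gr0_conv_Suc)
  define at_pt where "at_pt a c w = (if w = a then c else 0)" for a w :: "nat \<times> nat" and c :: real
  have stencil: "stiffness p (i, j) w =
      at_pt (i, j) (p (i - 1, j) + 2 * p (i, j) + p (i, j - 1)) w
      - at_pt (i + 1, j) (p (i, j)) w - at_pt (i - 1, j) (p (i - 1, j)) w
      - at_pt (i, j + 1) (p (i, j)) w - at_pt (i, j - 1) (p (i, j - 1)) w" for w
    unfolding a b by (cases w) (simp add: stiffness_def at_pt_def)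
  have pick: "(\<Sum>w\<in>interior_grid m n. at_pt a c w * u w) = c * u a" for a c
  proof -
    have "(\<Sum>w\<in>interior_grid m n. at_pt a c w * u w)
        = (\<Sum>w\<in>interior_grid m n. if w = a then c * u a else 0)"
      by (intro sum.cong) (auto simp: at_pt_def)
    also have "\<dots> = c * u a"
      using u by (cases a) (auto simp: finite_interior_grid supported_on_def)
    finally show ?thesis .
  qed
  have "kernel_apply (interior_grid m n) (stiffness p) u (i, j) =
      (p (i - 1, j) + 2 * p (i, j) + p (i, j - 1)) * u (i, j)
      - p (i, j) * u (i + 1, j) - p (i - 1, j) * u (i - 1, j)
      - p (i, j) * u (i, j + 1) - p (i, j - 1) * u (i, j - 1)"
    unfolding kernel_apply_def stencil left_diff_distrib sum_subtractf pick ..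
  then show ?thesis
    by (simp add: a b forward_diff1_def forward_diff2_def algebra_simps)
qed

lemma stiffness_critical_point_solves:
  assumes u: "u \<in> supported_on (interior_grid m n)"
    and crit: "\<And>z. z \<in> interior_grid m n \<Longrightarrow>
      kernel_apply (interior_grid m n) (stiffness p) u z = lam * f z (u z)"
  shows "solves_problem m n p f lam u"
  unfolding solves_problem_def
proof (intro conjI ballI)
  fix i j assume "i \<in> {1..m}" "j \<in> {1..n}"
  then show "- \<Delta>\<^sub>1 (\<lambda>(k, l). p (k - 1, l) * \<Delta>\<^sub>1 u (k - 1, l)) (i, j)
      - \<Delta>\<^sub>2 (\<lambda>(k, l). p (k, l - 1) * \<Delta>\<^sub>2 u (k, l - 1)) (i, j) = lam * f (i, j) (u (i, j))"
    using crit[of "(i, j)"] kernel_apply_stiffness[OF u, of i j p] by (simp add: interior_grid_def)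
qed (use u in \<open>auto simp: supported_on_def interior_grid_def\<close>)

text \<open>The block structure of \<open>M_matrix\<close> lists the grid row by row: a block fixes the ordinate, and the position within
the block gives the abscissa.\<close>
definition grid_point :: "nat \<Rightarrow> nat \<Rightarrow> nat \<times> nat" where
  "grid_point m r = (r mod m + 1, r div m + 1)"

lemma bij_betw_grid_point:
  assumes "1 \<le> m"
  shows "bij_betw (grid_point m) {..<m * n} (interior_grid m n)"
proof (rule bij_betwI[where g = "\<lambda>(i, j). (j - 1) * m + (i - 1)"])
  show "grid_point m \<in> {..<m * n} \<rightarrow> interior_grid m n"
    using assms by (auto simp: grid_point_def interior_grid_def Suc_le_eq less_mult_imp_div_less mult.commute)
  show "(\<lambda>(i, j). (j - 1) * m + (i - 1)) \<in> interior_grid m n \<rightarrow> {..<m * n}"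
  proof
    fix z assume "z \<in> interior_grid m n"
    then obtain i j where z: "z = (i, j)" and ij: "1 \<le> i" "i \<le> m" "1 \<le> j" "j \<le> n"
      by (auto simp: interior_grid_def)
    then have "(j - 1) * m + (i - 1) < (j - 1) * m + m" by linarith
    also have "\<dots> = j * m" using ij by (cases j) auto
    also have "\<dots> \<le> n * m" using ij by (intro mult_le_mono1)
    finally show "(case z of (i, j) \<Rightarrow> (j - 1) * m + (i - 1)) \<in> {..<m * n}"
      by (simp add: z mult.commute)
  qed
  show "grid_point m (case z of (i, j) \<Rightarrow> (j - 1) * m + (i - 1)) = z"
    if z_in: "z \<in> interior_grid m n" for z
  proof -
    obtain a b where z: "z = (Suc a, Suc b)" and "a < m"
      using z_in by (cases z) (auto simp: interior_grid_def Suc_le_eq gr0_conv_Suc)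
    then show ?thesis by (simp add: z grid_point_def)
  qed
qed (use assms in \<open>auto simp: grid_point_def interior_grid_def\<close>)

lemma M_block_entry:
  assumes "k < m" and "l < m"
  shows "M_block m p a b $$ (k, l) = stiffness p (k + 1, a) (l + 1, b)"
  using assms by (auto simp: M_block_def L_block_def P_block_def mat_diag_def stiffness_def)

lemma M_matrix_entry:
  assumes "r < m * n" and "c < m * n"
  shows "M_matrix m n p $$ (r, c) = stiffness p (grid_point m r) (grid_point m c)"
proof -
  have "m > 0" using assms by (cases m) auto
  then show ?thesis
    using assms by (simp add: M_matrix_def M_block_entry grid_point_def)
qed

text \<open>Reading a function on the grid as a vector, through the bijection \<open>grid_point\<close>, turns eigenfunctions of the
kernel into eigenvectors of the matrix. This is how the bound of the quadratic form is compared with the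
largest eigenvalue.\<close>
lemma eigenvalue_M_matrix:
  assumes "1 \<le> m"
    and eig: "\<And>z. z \<in> interior_grid m n \<Longrightarrow>
      kernel_apply (interior_grid m n) (stiffness p) v z = \<mu> * v z"
    and nz: "\<exists>z\<in>interior_grid m n. v z \<noteq> 0"
  shows "eigenvalue (M_matrix m n p) \<mu>"
proof -
  note bij = bij_betw_grid_point[OF \<open>1 \<le> m\<close>, of n]
  define x where "x = Matrix.vec (m * n) (\<lambda>r. v (grid_point m r))"
  have dims: "dim_row (M_matrix m n p) = m * n" "dim_col (M_matrix m n p) = m * n"
    by (simp_all add: M_matrix_def)
  have "M_matrix m n p *\<^sub>v x = \<mu> \<cdot>\<^sub>v x"
  proof (rule eq_vecI)
    fix r assume "r < dim_vec (\<mu> \<cdot>\<^sub>v x)"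
    then have r: "r < m * n" by (simp add: x_def)
    have "vec_index (M_matrix m n p *\<^sub>v x) r = (\<Sum>c<m * n. M_matrix m n p $$ (r, c) * v (grid_point m c))"
      using r by (simp add: dims x_def scalar_prod_def lessThan_atLeast0)
    also have "\<dots> = (\<Sum>c<m * n. stiffness p (grid_point m r) (grid_point m c) * v (grid_point m c))"
      using r by (intro sum.cong) (simp_all add: M_matrix_entry)
    also have "\<dots> = kernel_apply (interior_grid m n) (stiffness p) v (grid_point m r)"
      unfolding kernel_apply_def by (rule sum.reindex_bij_betw[OF bij])
    also have "\<dots> = \<mu> * v (grid_point m r)"
      using r bij_betw_apply[OF bij] by (intro eig) simp
    finally show "vec_index (M_matrix m n p *\<^sub>v x) r = vec_index (\<mu> \<cdot>\<^sub>v x) r"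
      using r by (simp add: x_def)
  qed (simp add: dims x_def)
  moreover have "x \<noteq> 0\<^sub>v (m * n)"
  proof
    assume x0: "x = 0\<^sub>v (m * n)"
    have "v (grid_point m r) = 0" if "r < m * n" for r
      using arg_cong[OF x0, of "\<lambda>y. vec_index y r"] that by (simp add: x_def)
    then show False
      using nz bij_betw_imp_surj_on[OF bij] by force
  qed
  ultimately show ?thesis
    unfolding eigenvalue_def eigenvector_def dims by (intro exI[of _ x]) (simp add: x_def)
qed

lemma eigenvalue_le_largest_eigenvalue:
  assumes "A \<in> carrier_mat k k" and "eigenvalue A \<mu>"
  shows "\<mu> \<le> largest_eigenvalue A"
  using assms card_finite_spectrum(1)[OF assms(1)]
  by (auto simp: largest_eigenvalue_def spectrum_def)

section \<open>Existence of a nontrivial solution\<close>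

text \<open>The fundamental theorem of calculus is applied on an interval with both 0 and \<open>x\<close> in its interior, so that the
oriented integral is covered for either sign of \<open>x\<close> and the derivative is two-sided.\<close>
lemma primitive_has_derivative:
  assumes "continuous_on UNIV (f z)"
  shows "(primitive f z has_real_derivative f z x) (at x)"
proof -
  define a b where "a = min 0 x - 1" and "b = max 0 x + 1"
  have "((\<lambda>u. LBINT t=ereal 0..ereal u. f z t) has_vector_derivative f z x) (at x within {a..b})"
    by (rule interval_integral_FTC2) (auto simp: a_def b_def intro: continuous_on_subset[OF assms])
  moreover have "at x within {a..b} = at x"
    by (rule at_within_interior) (auto simp: a_def b_def interior_atLeastAtMost_real)
  ultimately show ?thesis
    by (simp add: has_real_derivative_iff_has_vector_derivative primitive_def[abs_def])
qed

lemma primitive_0: "primitive f z 0 = 0"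
  by (simp add: primitive_def)

text \<open>
The variational principle is applied to \<open>stiffness p\<close> and the potential \<open>\<lambda> F\<close>; the bound \<open>\<mu>\<close> of the
quadratic form is an eigenvalue of \<open>M_matrix\<close>, which connects the principle to the threshold for \<open>\<lambda>\<close>.\<close>
theorem theorem4p4:
  fixes m n :: nat
    and p :: "nat \<times> nat \<Rightarrow> real"
    and f :: "nat \<times> nat \<Rightarrow> real \<Rightarrow> real"
    and \<alpha> \<beta> :: "nat \<times> nat \<Rightarrow> real"
    and K lam :: real
  assumes "m \<ge> 1" and "n \<ge> 1"
    and "admissible_weight m n p"
    and "\<And>z. z \<in> interior_grid m n \<Longrightarrow> continuous_on UNIV (f z)"
    and "\<And>z. z \<in> interior_grid m n \<Longrightarrow> 0 < \<alpha> z"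
    and "0 < K"
    and "\<And>z t. z \<in> interior_grid m n \<Longrightarrow> \<bar>t\<bar> > K \<Longrightarrow> primitive f z t \<ge> \<alpha> z * t\<^sup>2 + \<beta> z"
    and "\<And>z. z \<in> interior_grid m n \<Longrightarrow> ((\<lambda>t. primitive f z t / t\<^sup>2) \<longlongrightarrow> 0) (at 0)"
    and "0 < lam"
    and "lam > largest_eigenvalue (M_matrix m n p) / (2 * Min (\<alpha> ` interior_grid m n))"
  shows "\<exists>u. solves_problem m n p f lam u \<and> nontrivial m n u"
proof -
  define S where "S = interior_grid m n"
  define a where "a = Min (\<alpha> ` S)"
  note weight = \<open>admissible_weight m n p\<close>
  have fin: "finite S" by (simp add: S_def finite_interior_grid)
  have corner: "(1, 1) \<in> S" using \<open>m \<ge> 1\<close> \<open>n \<ge> 1\<close> by (simp add: S_def interior_grid_def)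
  then have "S \<noteq> {}" by blast
  have "a \<in> \<alpha> ` S" unfolding a_def using fin corner by (intro Min_in) auto
  then have "a > 0" using assms(5) by (auto simp: S_def)
  have a_le: "a \<le> \<alpha> z" if "z \<in> S" for z
    unfolding a_def using fin that by (intro Min_le) auto
  obtain \<mu> v where bound: "\<And>u. quad_form S (stiffness p) u \<le> \<mu> * (\<Sum>z\<in>S. (u z)\<^sup>2)"
    and nz: "\<exists>z\<in>S. v z \<noteq> 0"
    and eig: "\<And>z. z \<in> S \<Longrightarrow> kernel_apply S (stiffness p) v z = \<mu> * v z"
    using extremal_eigenpair[where S = S and A = "stiffness p", OF fin \<open>S \<noteq> {}\<close> stiffness_sym]
    by blast
  have "eigenvalue (M_matrix m n p) \<mu>"
    using eigenvalue_M_matrix[OF \<open>m \<ge> 1\<close>] eig nz unfolding S_def by blast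
  then have "\<mu> \<le> largest_eigenvalue (M_matrix m n p)"
    by (rule eigenvalue_le_largest_eigenvalue[where k = "m * n", rotated]) (simp add: M_matrix_def)
  also have "\<dots> < 2 * (lam * a)"
    using assms(10) \<open>a > 0\<close> by (simp add: a_def[symmetric] S_def[symmetric] field_simps)
  finally have gap: "\<mu> < 2 * (lam * a)" .
  have diag: "stiffness p (1, 1) (1, 1) > 0"
    using weight \<open>m \<ge> 1\<close> \<open>n \<ge> 1\<close> by (auto simp: stiffness_def admissible_weight_def)
  define G where "G z t = lam * primitive f z t" for z t
  have der: "(G z has_real_derivative lam * f z t) (at t)" if "z \<in> S" for z t
    unfolding G_def using assms(4) that
    by (intro DERIV_cmult primitive_has_derivative) (simp add: S_def)
  have zero: "G z 0 = 0" for z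
    by (simp add: G_def primitive_0)
  have low: "G z t \<ge> lam * a * t\<^sup>2 + lam * \<beta> z" if "z \<in> S" "\<bar>t\<bar> > K" for z t
  proof -
    have "a * t\<^sup>2 + \<beta> z \<le> \<alpha> z * t\<^sup>2 + \<beta> z"
      using a_le[OF that(1)] by (simp add: mult_right_mono)
    also have "\<dots> \<le> primitive f z t"
      using assms(7) that by (simp add: S_def)
    finally have "lam * (a * t\<^sup>2 + \<beta> z) \<le> lam * primitive f z t"
      using \<open>0 < lam\<close> by (intro mult_left_mono) auto
    then show ?thesis by (simp add: G_def algebra_simps)
  qed
  have lim: "((\<lambda>t. G (1, 1) t / t\<^sup>2) \<longlongrightarrow> 0) (at 0)"
    using tendsto_mult_right_zero[OF assms(8)[OF corner[unfolded S_def]], of lam]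
    by (simp add: G_def)
  obtain u where u: "u \<in> supported_on S"
    and crit: "\<And>z. z \<in> S \<Longrightarrow> kernel_apply S (stiffness p) u z = lam * f z (u z)"
    and "\<exists>z\<in>S. u z \<noteq> 0"
    using nontrivial_critical_point[where S = S and A = "stiffness p" and G = G
        and g = "\<lambda>z t. lam * f z t" and b = "\<lambda>z. lam * \<beta> z",
        OF fin corner diag stiffness_sym bound der zero low gap lim] by blast
  then have "nontrivial m n u" by (simp add: nontrivial_def S_def)
  moreover have "solves_problem m n p f lam u"
    using u crit unfolding S_def by (rule stiffness_critical_point_solves)
  ultimately show ?thesis by blast
qed

end
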